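(* Let $F$ be a fixed graph on $m$ vertices and let $d$ be a real number for which there exist an ordering $v_1, v_2, \ldots, v_m$ of the vertices of $F$ and an integer $k$ with $1 \le k \le m$ such that: (1) the induced subgraph $F[\{v_k, \ldots, v_m\}]$ is a forest; (2) for all edges $v_iv_j$ of $F$ with $i<j$ and $i<k$, we have $N_{<i}(v_i) + N_{<i}(v_j) \le 2d$; and (3) for all edges $v_iv_j$ of $F$ with $k \le i < j$, we have $N_{<k}(v_i) + N_{<k}(v_j) \le 2d$. Then $\mathrm{exp}(F) \le 1 - \frac{1}{2d+1}$.
   Context: Graphs are finite and simple. For an ordering $v_1,\ldots,v_m$ of $V(F)$, an index $i$ and a vertex $v$ of $F$, $N_{<i}(v)$ denotes the number of neighbors of $v$ in $\{v_1,\ldots,v_{i-1}\}$. For a graph $G$ and $X,Y\subset V(G)$, $e(X,Y)$ is the number of edges of $G$ with one vertex in $X$ and one vertex in $Y$, where edges with both vertices in $X\cap Y$ are counted twice. For real numbers $p\in[0,1]$ and $\alpha\ge 0$, $G$ is $(p,\alpha)$-jumbled if $\left|e(X,Y)-p|X||Y|\right|\le \alpha\sqrt{|X||Y|}$ for all $X,Y\subset V(G)$. A graph is $\mathcal{F}$-free, for a family $\mathcal{F}$ of graphs, if it contains no member of $\mathcal{F}$ as a (not necessarily induced) subgraph. For $C>0$, $\mathrm{ex}_{\mathrm{rand}}(n,C,\mathcal{F})$ is the maximum number of edges in an $n$-vertex $\mathcal{F}$-free graph that is $(p,\alpha)$-jumbled for some $p\in[0,1]$ and some $\alpha\ge 0$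 with $\alpha\le C\sqrt{np}$ (there is no restriction on $p$). Define $$\mathrm{exp}(\mathcal{F})=\lim_{C\to\infty}\limsup_{n\to\infty}\frac{\log\left(\mathrm{ex}_{\mathrm{rand}}(n,C,\mathcal{F})/n\right)}{\log n},$$ and write $\mathrm{exp}(F)=\mathrm{exp}(\{F\})$. *)

theory Defs
  imports "HOL-Analysis.Analysis"
begin

type_synonym 'a ugraph = "'a set \<times> 'a set set"

abbreviation verts :: "'a ugraph \<Rightarrow> 'a set" where "verts \<equiv> fst"
abbreviation edges :: "'a ugraph \<Rightarrow> 'a set set" where "edges \<equiv> snd"

definition simple_graph :: "'a ugraph \<Rightarrow> bool" where
  "simple_graph G \<longleftrightarrow> finite (verts G) \<and> (\<forall>e\<in>edges G. e \<subseteq> verts G \<and> card e = 2)"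

definition induced_subgraph :: "'a ugraph \<Rightarrow> 'a set \<Rightarrow> 'a ugraph" where
  "induced_subgraph G S = (verts G \<inter> S, {e \<in> edges G. e \<subseteq> S})"

text \<open>A cycle is given by the cyclic sequence of its (at least three, pairwise distinct) vertices.\<close>

definition is_cycle :: "'a ugraph \<Rightarrow> 'a list \<Rightarrow> bool" where
  "is_cycle G c \<longleftrightarrow> length c \<ge> 3 \<and> distinct c \<and>
     (\<forall>i<length c. {c ! i, c ! (Suc i mod length c)} \<in> edges G)"

definition forest :: "'a ugraph \<Rightarrow> bool" where
  "forest G \<longleftrightarrow> (\<nexists>c. is_cycle G c)"

definition contains_copy :: "'b ugraph \<Rightarrow> 'a ugraph \<Rightarrow> bool" where
  "contains_copy G F \<longleftrightarrow> (\<exists>f. inj_on f (verts F) \<and> f ` verts F \<subseteq> verts G \<and>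
     (\<forall>e\<in>edges F. f ` e \<in> edges G))"

definition free_of :: "'a ugraph set \<Rightarrow> 'b ugraph \<Rightarrow> bool" where
  "free_of \<F> G \<longleftrightarrow> (\<forall>F\<in>\<F>. \<not> contains_copy G F)"

text \<open>The second summand counts the edges inside \<open>X \<inter> Y\<close> a second time.\<close>

definition e_between :: "'a ugraph \<Rightarrow> 'a set \<Rightarrow> 'a set \<Rightarrow> nat" where
  "e_between G X Y = card {e \<in> edges G. \<exists>x\<in>X. \<exists>y\<in>Y. e = {x, y}}
     + card {e \<in> edges G. e \<subseteq> X \<inter> Y}"

definition jumbled :: "real \<Rightarrow> real \<Rightarrow> 'a ugraph \<Rightarrow> bool" where
  "jumbled p \<alpha> G \<longleftrightarrow> 0 \<le> p \<and> p \<le> 1 \<and> 0 \<le> \<alpha> \<and>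
     (\<forall>X Y. X \<subseteq> verts G \<longrightarrow> Y \<subseteq> verts G \<longrightarrow>
        \<bar>real (e_between G X Y) - p * real (card X) * real (card Y)\<bar>
          \<le> \<alpha> * sqrt (real (card X) * real (card Y)))"

text \<open>The supremum is over a finite set of naturals, so it is the maximum if such a graph exists;
  if none exists it is \<open>0\<close>. Taking the vertices in \<open>nat\<close> loses no graph up to isomorphism.\<close>

definition ex_rand :: "nat \<Rightarrow> real \<Rightarrow> 'a ugraph set \<Rightarrow> nat" where
  "ex_rand n C \<F> = Sup {card (edges G) | G :: nat ugraph.
     simple_graph G \<and> card (verts G) = n \<and> free_of \<F> G \<and>
     (\<exists>p \<alpha>. jumbled p \<alpha> G \<and> \<alpha> \<le> C * sqrt (real n * p))}"

text \<open>The natural logarithm of a nonnegative real, with \<open>log 0 = -\<infinity>\<close>.\<close>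

definition log_ereal :: "real \<Rightarrow> ereal" where
  "log_ereal x = (if x \<le> 0 then -\<infinity> else ereal (ln x))"

text \<open>The limit always exists in \<open>ereal\<close>, since \<open>ex_rand n C \<F>\<close> is nondecreasing in \<open>C\<close>.\<close>

definition exp_rand_family :: "'a ugraph set \<Rightarrow> ereal" where
  "exp_rand_family \<F> = Lim at_top (\<lambda>C :: real.
     limsup (\<lambda>n. log_ereal (real (ex_rand n C \<F>) / real n) / ereal (ln (real n))))"

definition exp_rand :: "'a ugraph \<Rightarrow> ereal" where
  "exp_rand F = exp_rand_family {F}"

text \<open>\<open>nbrs_before F v i x\<close> is \<open>N\<^sub><\<^sub>i(x)\<close> for the ordering \<open>v 1, v 2, \<dots>\<close> of the vertices.\<close>

definition nbrs_before :: "'a ugraph \<Rightarrow> (nat \<Rightarrow> 'a) \<Rightarrow> nat \<Rightarrow> 'a \<Rightarrow> nat" where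
  "nbrs_before F v i x = card {y \<in> v ` {1..<i}. {x, y} \<in> edges F}"

end

theory Submission
  imports Defs
begin

text \<open>In a jumbled graph of density \<open>p\<close>, two disjoint sets with \<open>|X| |Y|\<close> larger than a constant
  times \<open>n / p\<close> cannot have every vertex of \<open>X\<close> joined to less than half the expected number of
  vertices of \<open>Y\<close>. Embed \<open>v\<^sub>1, \<dots>, v\<^sub>k\<^sub>-\<^sub>1\<close> greedily into disjoint parts, so that each candidate set
  shrinks by a factor of at worst \<open>p / 2\<close> per embedded neighbour. The degree conditions keep the
  product of the candidate set sizes of adjacent vertices above the threshold as long as
  \<open>n p\<^bsup>2 d + 1\<^esup>\<close> is large, and then the remaining forest can be embedded too. So the density of
  an \<open>F\<close>-free graph is \<open>O(n\<^bsup>- 1 / (2 d + 1)\<^esup>)\<close>.\<close>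

section \<open>Leaves of forests\<close>

text \<open>Longest path argument: all neighbours in \<open>S\<close> of the first vertex of a
  longest path lie on the path, and one other than the second vertex would close a cycle. The vertex
  \<open>y\<close> is unrestricted, so isolated vertices count as leaves too.\<close>

lemma forest_has_leaf:
  assumes "simple_graph F" "finite S" "S \<noteq> {}" "forest (induced_subgraph F S)"
  shows "\<exists>x\<in>S. \<exists>y. \<forall>z\<in>S. {x, z} \<in> edges F \<longrightarrow> z = y"
proof (rule ccontr)
  assume no_leaf: "\<not> ?thesis"
  define path where "path xs \<longleftrightarrow> xs \<noteq> [] \<and> distinct xs \<and> set xs \<subseteq> S \<and>
    (\<forall>i. Suc i < length xs \<longrightarrow> {xs ! i, xs ! Suc i} \<in> edges F)" for xs
  have loopless: "{x, x} \<notin> edges F" for x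
    using assms(1) by (auto simp: simple_graph_def)
  obtain a where "a \<in> S" using assms(3) by blast
  then have "path [a]" by (simp add: path_def)
  moreover have "\<forall>xs. path xs \<longrightarrow> length xs < Suc (card S)"
    using assms(2) by (metis card_mono distinct_card le_imp_less_Suc path_def)
  ultimately obtain xs where xs: "path xs"
    and longest: "\<And>ys. path ys \<Longrightarrow> length ys \<le> length xs"
    using ex_has_greatest_nat[of path "[a]" length] by blast
  have inS: "xs ! 0 \<in> S" using xs by (auto simp: path_def)
  \<comment> \<open>The negated claim is used with \<open>y\<close> equal to \<open>xs ! 1\<close>.
    On a one-vertex path this value is unspecified, which does no harm: it only serves to exclude
    \<open>j = 1\<close>, where the path has at least two vertices.\<close>
  obtain z where z: "z \<in> S" "{xs ! 0, z} \<in> edges F" "z \<noteq> xs ! 1"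
    using no_leaf inS by blast
  have "z \<in> set xs"
  proof (rule ccontr)
    assume "z \<notin> set xs"
    then have "path (z # xs)"
      using xs z by (auto simp: path_def nth_Cons insert_commute split: nat.split)
    then show False using longest by fastforce
  qed
  then obtain j where j: "j < length xs" "z = xs ! j" by (metis in_set_conv_nth)
  have "j \<noteq> 0" "j \<noteq> 1" using z j loopless by (auto intro: gr0I)
  then have j2: "2 \<le> j" by simp
  let ?c = "take (Suc j) xs"
  have len: "length ?c = Suc j" using j by simp
  have "{?c ! i, ?c ! (Suc i mod length ?c)} \<in> edges (induced_subgraph F S)"
    if "i < length ?c" for i
  proof (cases "i = j")
    case True
    then show ?thesis using z j inS len by (simp add: induced_subgraph_def insert_commute)
  next
    case False
    then have "Suc i < Suc j" using that len by simp
    then show ?thesis using xs j len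
      by (auto simp: induced_subgraph_def path_def subset_iff)
  qed
  then have "is_cycle (induced_subgraph F S) ?c"
    using xs j2 len by (auto simp: is_cycle_def path_def)
  then show False using assms(4) by (auto simp: forest_def)
qed

section \<open>One-sided mixing and the embedding of forests\<close>

definition nbhd :: "'a ugraph \<Rightarrow> 'a \<Rightarrow> 'a set" where
  "nbhd G x = {y. {x, y} \<in> edges G}"

text \<open>The lower half of jumbledness in contrapositive form: if \<open>X\<close> and
  \<open>Y\<close> are disjoint and \<open>|X| |Y|\<close> exceeds \<open>D\<close>, some vertex of
  \<open>X\<close> has more than \<open>q |Y|\<close> neighbours in \<open>Y\<close>. Applied to a
  set \<open>X\<close> of bad vertices, it bounds their number.\<close>

definition mixing :: "'a ugraph \<Rightarrow> real \<Rightarrow> real \<Rightarrow> bool" where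
  "mixing G q D \<longleftrightarrow> (\<forall>X Y. X \<subseteq> verts G \<longrightarrow> Y \<subseteq> verts G \<longrightarrow> X \<inter> Y = {} \<longrightarrow>
     (\<forall>x\<in>X. real (card (nbhd G x \<inter> Y)) \<le> q * real (card Y)) \<longrightarrow>
     real (card X) * real (card Y) \<le> D)"

lemma mixingD:
  assumes "mixing G q D" "X \<subseteq> verts G" "Y \<subseteq> verts G" "X \<inter> Y = {}"
    and "\<And>x. x \<in> X \<Longrightarrow> real (card (nbhd G x \<inter> Y)) \<le> q * real (card Y)"
  shows "real (card X) * real (card Y) \<le> D"
  using assms(1)[unfolded mixing_def, rule_format, OF assms(2-4)] assms(5) by simp

text \<open>Each edge between the sets comes from some \<open>x\<close> and one of its neighbours in
  \<open>Y\<close>; disjointness removes the second summand of \<open>e_between\<close>.\<close>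

lemma e_between_le_sum_nbhd:
  assumes "simple_graph G" "X \<subseteq> verts G" "Y \<subseteq> verts G" "X \<inter> Y = {}"
  shows "e_between G X Y \<le> (\<Sum>x\<in>X. card (nbhd G x \<inter> Y))"
proof -
  have fin: "finite X" "finite Y"
    using assms by (auto simp: simple_graph_def intro: finite_subset)
  have "e \<noteq> {}" if "e \<in> edges G" for e
    using that assms(1) by (auto simp: simple_graph_def)
  then have none: "{e \<in> edges G. e \<subseteq> X \<inter> Y} = {}" using assms(4) by auto
  have "{e \<in> edges G. \<exists>x\<in>X. \<exists>y\<in>Y. e = {x, y}}
      \<subseteq> (\<lambda>(x, y). {x, y}) ` (SIGMA x:X. nbhd G x \<inter> Y)"
    by (auto simp: nbhd_def)
  then have "card {e \<in> edges G. \<exists>x\<in>X. \<exists>y\<in>Y. e = {x, y}} \<le> card (SIGMA x:X. nbhd G x \<inter> Y)"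
    by (meson card_image_le card_mono fin finite_Int finite_SigmaI finite_imageI le_trans)
  also have "card (SIGMA x:X. nbhd G x \<inter> Y) = (\<Sum>x\<in>X. card (nbhd G x \<inter> Y))"
    using fin by simp
  finally show ?thesis unfolding e_between_def none by simp
qed

text \<open>Let \<open>z\<close> be the square root of \<open>|X| |Y|\<close>. The small degrees
  allow at most \<open>p z^2 / 2\<close> edges, while jumbledness forces at least
  \<open>p z^2 - \<alpha> z\<close>. Hence \<open>z \<le> 2 \<alpha> / p\<close>, and squaring gives
  the threshold.\<close>

lemma jumbled_imp_mixing:
  assumes "simple_graph G" "jumbled p \<alpha> G" "0 < p"
  shows "mixing G (p / 2) (4 * \<alpha>\<^sup>2 / p\<^sup>2)"
  unfolding mixing_def
proof (intro allI impI)
  fix X Y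
  assume XY: "X \<subseteq> verts G" "Y \<subseteq> verts G" "X \<inter> Y = {}"
    and few: "\<forall>x\<in>X. real (card (nbhd G x \<inter> Y)) \<le> p / 2 * real (card Y)"
  define z where "z = sqrt (real (card X) * real (card Y))"
  have z: "0 \<le> z" "real (card X) * real (card Y) = z\<^sup>2" by (auto simp: z_def)
  have "real (e_between G X Y) \<le> (\<Sum>x\<in>X. real (card (nbhd G x \<inter> Y)))"
    using e_between_le_sum_nbhd[OF assms(1) XY]
    by (metis of_nat_le_iff of_nat_sum)
  also have "\<dots> \<le> real (card X) * (p / 2 * real (card Y))"
    using few by (intro sum_bounded_above) auto
  finally have "real (e_between G X Y) \<le> p / 2 * z\<^sup>2" using z(2) by (simp add: algebra_simps)
  moreover have "p * z\<^sup>2 - \<alpha> * z \<le> real (e_between G X Y)"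
    using assms(2) XY z(2) unfolding jumbled_def z_def[symmetric]
    by (smt (verit, best) mult.assoc z_def)
  ultimately have "p * z\<^sup>2 \<le> 2 * \<alpha> * z" by linarith
  then have "(p * z) * z \<le> (2 * \<alpha>) * z" by (simp add: power2_eq_square mult.assoc)
  then have "z = 0 \<or> p * z \<le> 2 * \<alpha>"
    using z(1) mult_right_le_imp_le[of "p * z" z "2 * \<alpha>"] by linarith
  then have "z = 0 \<or> z \<le> 2 * \<alpha> / p"
    using assms(3) by (simp add: pos_le_divide_eq mult.commute)
  then have "z\<^sup>2 \<le> (2 * \<alpha> / p)\<^sup>2" using z(1) by (auto intro: power_mono)
  then show "real (card X) * real (card Y) \<le> 4 * \<alpha>\<^sup>2 / p\<^sup>2"
    using z(2) by (simp add: power_divide power_mult_distrib)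
qed

text \<open>The invariant \<open>s x * card S \<le> card (T x)\<close> is chosen so that deleting a leaf \<open>l\<close> with
  neighbour \<open>u\<close> is free: at most \<open>s u\<close> vertices of \<open>T u\<close> have no neighbour in \<open>T l\<close>.\<close>

lemma forest_embedding:
  assumes "simple_graph F" "simple_graph G" "mixing G q D" "0 \<le> q"
    and "finite S" "forest (induced_subgraph F S)"
    and "\<And>x. x \<in> S \<Longrightarrow> T x \<subseteq> verts G"
    and "\<And>x y. x \<in> S \<Longrightarrow> y \<in> S \<Longrightarrow> x \<noteq> y \<Longrightarrow> T x \<inter> T y = {}"
    and "\<And>x. x \<in> S \<Longrightarrow> 0 < s x"
    and "\<And>x. x \<in> S \<Longrightarrow> s x * real (card S) \<le> real (card (T x))"
    and "\<And>x y. x \<in> S \<Longrightarrow> y \<in> S \<Longrightarrow> {x, y} \<in> edges F \<Longrightarrow> D < s x * s y"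
  shows "\<exists>\<phi>. (\<forall>x\<in>S. \<phi> x \<in> T x) \<and>
    (\<forall>x\<in>S. \<forall>y\<in>S. {x, y} \<in> edges F \<longrightarrow> {\<phi> x, \<phi> y} \<in> edges G)"
  using assms(5-11)
proof (induction "card S" arbitrary: S T)
  case 0
  then show ?case by auto
next
  case (Suc n)
  have "S \<noteq> {}" using Suc.hyps(2) by auto
  then obtain l u where l: "l \<in> S" and u: "\<And>z. z \<in> S \<Longrightarrow> {l, z} \<in> edges F \<Longrightarrow> z = u"
    using forest_has_leaf[OF assms(1) Suc.prems(1) _ Suc.prems(2)] by blast
  have loopless: "{x, x} \<notin> edges F" for x
    using assms(1) by (auto simp: simple_graph_def)
  \<comment> \<open>Within \<open>S\<close> only the set of \<open>u\<close> can change: its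
    candidates without a neighbour in \<open>T l\<close> are discarded, so that \<open>l\<close> can
    be embedded last.\<close>
  define T' where
    "T' x = (if {l, x} \<in> edges F then {t \<in> T x. nbhd G t \<inter> T l \<noteq> {}} else T x)" for x
  have fin: "finite (T x)" if "x \<in> S" for x
    using that Suc.prems(3) assms(2) by (auto simp: simple_graph_def intro: finite_subset)
  have cardS: "card (S - {l}) = n" using Suc.hyps(2) Suc.prems(1) l by simp
  have large: "s x * real n \<le> real (card (T' x))" if x: "x \<in> S - {l}" for x
  proof (cases "{l, x} \<in> edges F")
    case False
    have "s x * real n \<le> s x * real (card S)"
      using x Suc.hyps(2) Suc.prems(5)[of x] by (intro mult_left_mono) auto
    then show ?thesis using x Suc.prems(6)[of x] False by (simp add: T'_def)
  next
    case True
    define B where "B = {t \<in> T x. nbhd G t \<inter> T l = {}}"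
    \<comment> \<open>Members of \<open>B\<close> have no neighbour at all in \<open>T l\<close>, so
      mixing applies as soon as \<open>q\<close> is nonnegative. Comparison with
      \<open>D < s x * s l\<close> and \<open>s l \<le> card (T l)\<close> then gives
      \<open>card B < s x\<close>.\<close>
    have "real (card B) * real (card (T l)) \<le> D"
      using Suc.prems(3)[of x] Suc.prems(3)[of l] Suc.prems(4)[of x l] x l assms(4)
      by (intro mixingD[OF assms(3)]) (auto simp: B_def)
    also have "D < s x * s l" using Suc.prems(7)[of x l] x l True by (simp add: insert_commute)
    also have "s l \<le> real (card (T l))"
      using Suc.prems(5,6)[OF l] Suc.hyps(2)
      by (smt (verit, best) mult_le_cancel_left1 of_nat_1 of_nat_le_iff le_add1 plus_1_eq_Suc)
    then have "s x * s l \<le> s x * real (card (T l))"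
      using Suc.prems(5)[of x] x by (intro mult_left_mono) auto
    finally have "real (card B) < s x"
      by (metis mult_right_less_imp_less of_nat_0_le_iff)
    moreover have "card (T' x) + card B = card (T x)"
    proof -
      have "T x = T' x \<union> B" "T' x \<inter> B = {}" using True by (auto simp: T'_def B_def)
      then show ?thesis using fin[of x] x by (metis DiffD1 card_Un_disjoint finite_Un)
    qed
    then have "real (card (T' x)) = real (card (T x)) - real (card B)" by linarith
    moreover have "s x * real (card S) \<le> real (card (T x))" using Suc.prems(6) x by simp
    moreover have "real (card S) = real n + 1" using Suc.hyps(2) by simp
    ultimately show ?thesis by (simp add: distrib_left)
  qed
  have "forest (induced_subgraph F (S - {l}))"
    using Suc.prems(2) unfolding forest_def is_cycle_def induced_subgraph_def
    by (auto simp: subset_Diff_insert)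
  then have "\<exists>\<phi>. (\<forall>x\<in>S - {l}. \<phi> x \<in> T' x) \<and>
    (\<forall>x\<in>S - {l}. \<forall>y\<in>S - {l}. {x, y} \<in> edges F \<longrightarrow> {\<phi> x, \<phi> y} \<in> edges G)"
  \<comment> \<open>The function \<open>s\<close> stays the same for the smaller set, so the
    condition \<open>D < s x * s y\<close> on edges is inherited.\<close>
  proof (rule Suc.hyps(1)[OF cardS[symmetric], rotated 1])
    show "T' x \<subseteq> verts G" if "x \<in> S - {l}" for x
      using that Suc.prems(3)[of x] by (auto simp: T'_def)
    show "T' x \<inter> T' y = {}" if "x \<in> S - {l}" "y \<in> S - {l}" "x \<noteq> y" for x y
      using that Suc.prems(4)[of x y] by (auto simp: T'_def)
    show "s x * real (card (S - {l})) \<le> real (card (T' x))" if "x \<in> S - {l}" for x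
      using large[OF that] cardS by simp
  qed (use Suc.prems in auto)
  then obtain \<phi> where \<phi>: "\<And>x. x \<in> S - {l} \<Longrightarrow> \<phi> x \<in> T' x"
    and hom: "\<And>x y. x \<in> S - {l} \<Longrightarrow> y \<in> S - {l} \<Longrightarrow> {x, y} \<in> edges F \<Longrightarrow> {\<phi> x, \<phi> y} \<in> edges G"
    by blast
  have "0 < s l * real (card S)" using Suc.prems(5)[OF l] Suc.hyps(2) by simp
  then have "T l \<noteq> {}" using Suc.prems(6)[OF l] by auto
  \<comment> \<open>If \<open>u\<close> is a neighbour of \<open>l\<close> in \<open>S\<close>, then
    \<open>\<phi> u\<close> survived the pruning and has a neighbour in \<open>T l\<close>;
    otherwise any element of \<open>T l\<close> will do.\<close>
  then obtain t where t: "t \<in> T l"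
    and adj: "u \<in> S \<Longrightarrow> {l, u} \<in> edges F \<Longrightarrow> {\<phi> u, t} \<in> edges G"
  proof (cases "u \<in> S \<and> {l, u} \<in> edges F")
    case True
    then have "\<phi> u \<in> T' u" using \<phi> loopless by (metis DiffI singletonD)
    then have "nbhd G (\<phi> u) \<inter> T l \<noteq> {}" using True by (simp add: T'_def)
    then show ?thesis using that by (auto simp: nbhd_def)
  qed auto
  have "(\<phi>(l := t)) x \<in> T x" if "x \<in> S" for x
    using that t \<phi>[of x] by (auto simp: T'_def split: if_splits)
  moreover have "{(\<phi>(l := t)) x, (\<phi>(l := t)) y} \<in> edges G"
    if xy: "x \<in> S" "y \<in> S" "{x, y} \<in> edges F" for x y
  proof (cases "x = l \<or> y = l")
    case False
    then show ?thesis using hom xy by auto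
  next
    case True
    moreover have "x \<noteq> y" using xy(3) loopless by auto
    moreover have "x = l \<Longrightarrow> y = u" "y = l \<Longrightarrow> x = u"
      using xy u by (auto simp: insert_commute)
    ultimately show ?thesis using xy adj by (auto simp: insert_commute)
  qed
  ultimately show ?case by (intro exI[of _ "\<phi>(l := t)"]) blast
qed

section \<open>Greedy embedding along the ordering\<close>

definition candidates ::
    "'b ugraph \<Rightarrow> 'a ugraph \<Rightarrow> ('a \<Rightarrow> 'b set) \<Rightarrow> ('a \<Rightarrow> 'b) \<Rightarrow> 'a set \<Rightarrow> 'a \<Rightarrow> 'b set" where
  "candidates G F W \<phi> U x = {t \<in> W x. \<forall>y\<in>U. {x, y} \<in> edges F \<longrightarrow> {\<phi> y, t} \<in> edges G}"

lemma candidates_insert: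
  assumes "u \<notin> U"
  shows "candidates G F W (\<phi>(u := t)) (insert u U) x =
    (if {x, u} \<in> edges F then nbhd G t \<inter> candidates G F W \<phi> U x else candidates G F W \<phi> U x)"
  using assms by (auto simp: candidates_def nbhd_def)

text \<open>The case split matches that of \<open>candidates_insert\<close>: the exponent of
  \<open>q\<close> rises by one exactly when a candidate set is cut down to a neighbourhood. By
  injectivity \<open>v i\<close> has not been counted before.\<close>

lemma nbrs_before_Suc:
  assumes "inj_on v {1..m}" "1 \<le> i" "i \<le> m"
  shows "nbrs_before F v (Suc i) x =
    nbrs_before F v i x + (if {x, v i} \<in> edges F then 1 else 0)"
proof -
  have "v ` {1..<Suc i} = insert (v i) (v ` {1..<i})"
    using assms(2) by (simp add: atLeastLessThanSuc)
  moreover have "v i \<notin> v ` {1..<i}"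
    using inj_onD[OF assms(1), of i] assms(2,3) by fastforce
  moreover have "{y \<in> insert (v i) U. {x, y} \<in> edges F} =
      (if {x, v i} \<in> edges F then insert (v i) else id) {y \<in> U. {x, y} \<in> edges F}" for U
    by auto
  ultimately show ?thesis unfolding nbrs_before_def by (simp only:) simp
qed

definition admissible :: "'a ugraph \<Rightarrow> nat \<Rightarrow> real \<Rightarrow> (nat \<Rightarrow> 'a) \<Rightarrow> nat \<Rightarrow> bool" where
  "admissible F m d v k \<longleftrightarrow>
     bij_betw v {1..m} (verts F) \<and> 1 \<le> k \<and> k \<le> m \<and>
     forest (induced_subgraph F (v ` {k..m})) \<and>
     (\<forall>i\<in>{1..m}. \<forall>j\<in>{1..m}. {v i, v j} \<in> edges F \<and> i < j \<and> i < k \<longrightarrow>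
        real (nbrs_before F v i (v i)) + real (nbrs_before F v i (v j)) \<le> 2 * d) \<and>
     (\<forall>i\<in>{1..m}. \<forall>j\<in>{1..m}. {v i, v j} \<in> edges F \<and> k \<le> i \<and> i < j \<longrightarrow>
        real (nbrs_before F v k (v i)) + real (nbrs_before F v k (v j)) \<le> 2 * d)"

lemma admissibleD:
  assumes "admissible F m d v k"
  shows "bij_betw v {1..m} (verts F)" and "1 \<le> k" and "k \<le> m"
    and "forest (induced_subgraph F (v ` {k..m}))"
    and "i \<in> {1..m} \<Longrightarrow> j \<in> {1..m} \<Longrightarrow> {v i, v j} \<in> edges F \<Longrightarrow> i < j \<Longrightarrow> i < k \<Longrightarrow>
      real (nbrs_before F v i (v i)) + real (nbrs_before F v i (v j)) \<le> 2 * d"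
    and "i \<in> {1..m} \<Longrightarrow> j \<in> {1..m} \<Longrightarrow> {v i, v j} \<in> edges F \<Longrightarrow> k \<le> i \<Longrightarrow> i < j \<Longrightarrow>
      real (nbrs_before F v k (v i)) + real (nbrs_before F v k (v j)) \<le> 2 * d"
  using assms unfolding admissible_def by (simp_all del: One_nat_def)

text \<open>The first \<open>k - 1\<close> vertices are embedded one by one, then the forest all at
  once. For adjacent vertices the exponents of \<open>q\<close> add up to at most
  \<open>2 * d\<close>, so the product of their candidate set sizes exceeds \<open>m^2 D\<close>.
  One factor \<open>m\<close> pays for the union bound in the greedy phase; the forest phase needs
  both.\<close>

lemma degenerate_forest_embedding:
  fixes F :: "'a ugraph" and G :: "'b ugraph"
  assumes F: "simple_graph F" and G: "simple_graph G"
    and mix: "mixing G q D" and q: "0 < q" "q \<le> 1" and D: "0 \<le> D" and s: "0 < s"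
    and size: "(real m)\<^sup>2 * D < s\<^sup>2 * q powr (2 * d)"
    and W: "\<And>x. x \<in> verts F \<Longrightarrow> W x \<subseteq> verts G"
    and W_large: "\<And>x. x \<in> verts F \<Longrightarrow> s \<le> real (card (W x))"
    and W_disj: "\<And>x y. x \<in> verts F \<Longrightarrow> y \<in> verts F \<Longrightarrow> x \<noteq> y \<Longrightarrow> W x \<inter> W y = {}"
    and adm: "admissible F m d v k"
  shows "contains_copy G F"
proof -
  note v = admissibleD(1)[OF adm] and k = admissibleD(2,3)[OF adm]
    and forest = admissibleD(4)[OF adm]
    and early = admissibleD(5)[OF adm] and late = admissibleD(6)[OF adm]
  have inj: "inj_on v {1..m}" and img: "v ` {1..m} = verts F"
    using v by (auto simp: bij_betw_def)
  have vV: "v i \<in> verts F" if "1 \<le> i" "i \<le> m" for i using that img by auto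
  have loopless: "{x, x} \<notin> edges F" for x
    using F by (auto simp: simple_graph_def)
  have m: "1 \<le> real m" using k by simp
  \<comment> \<open>Since \<open>q \<le> 1\<close>, raising the exponent from \<open>a + b\<close>
    to \<open>2 * d\<close> only makes the power smaller.\<close>
  have product: "(real m)\<^sup>2 * D < x * y"
    if "s * q ^ a \<le> x" "s * q ^ b \<le> y" "real a + real b \<le> 2 * d" for x y a b
  proof -
    have "q powr (2 * d) \<le> q powr (real (a + b))"
      using that(3) q by (intro powr_mono') auto
    also have "\<dots> = q ^ a * q ^ b" using q by (simp add: powr_realpow power_add flip: of_nat_add)
    finally have "s\<^sup>2 * q powr (2 * d) \<le> s\<^sup>2 * (q ^ a * q ^ b)"
      by (intro mult_left_mono) auto
    also have "\<dots> = (s * q ^ a) * (s * q ^ b)" by (simp add: power2_eq_square)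
    also have "\<dots> \<le> x * y" using that(1,2) s q
      by (intro mult_mono) (auto intro: order_trans[OF _ that(1)])
    finally show ?thesis using size by linarith
  qed
  let ?U = "\<lambda>i. v ` {1..<i}"
  \<comment> \<open>Induction on the stage: each vertex still to be embedded keeps at least
    \<open>s\<close> candidates times one factor \<open>q\<close> per embedded neighbour.\<close>
  have "\<exists>\<phi>. (\<forall>x\<in>?U k. \<phi> x \<in> W x) \<and>
      (\<forall>x\<in>?U k. \<forall>y\<in>?U k. {x, y} \<in> edges F \<longrightarrow> {\<phi> x, \<phi> y} \<in> edges G) \<and>
      (\<forall>j\<in>{k..m}. s * q ^ nbrs_before F v k (v j) \<le> real (card (candidates G F W \<phi> (?U k) (v j))))"
    using k(1)
  proof (induction k rule: dec_induct)
    case base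
    show ?case using W_large[OF vV] by (auto simp: nbrs_before_def candidates_def)
  next
    case (step i)
    then have i: "1 \<le> i" "i < k" "i \<le> m" using k by auto
    obtain \<phi> where \<phi>: "\<And>x. x \<in> ?U i \<Longrightarrow> \<phi> x \<in> W x"
      and hom: "\<And>x y. x \<in> ?U i \<Longrightarrow> y \<in> ?U i \<Longrightarrow> {x, y} \<in> edges F \<Longrightarrow> {\<phi> x, \<phi> y} \<in> edges G"
      and large: "\<And>j. i \<le> j \<Longrightarrow> j \<le> m \<Longrightarrow>
        s * q ^ nbrs_before F v i (v j) \<le> real (card (candidates G F W \<phi> (?U i) (v j)))"
      using step.IH by fastforce
    define T where "T j = candidates G F W \<phi> (?U i) (v j)" for j
    \<comment> \<open>\<open>J\<close> indexes the later neighbours of \<open>v i\<close>, and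
      \<open>B j\<close> holds the choices for \<open>v i\<close> that would leave too small a part
      of \<open>T j\<close>.\<close>
    define J where "J = {j. i < j \<and> j \<le> m \<and> {v i, v j} \<in> edges F}"
    define B where
      "B j = {t \<in> T i. real (card (nbhd G t \<inter> T j)) \<le> q * real (card (T j))}" for j
    have TW: "T j \<subseteq> W (v j)" for j by (auto simp: T_def candidates_def)
    have Tpos: "0 < card (T j)" if "i \<le> j" "j \<le> m" for j
    proof -
      have "0 < s * q ^ nbrs_before F v i (v j)" using s q by simp
      then show ?thesis using large[OF that] by (simp add: T_def)
    qed
    have finT: "finite (T i)" using Tpos[of i] i card_gt_0_iff by blast
    have J: "J \<subseteq> {Suc i..m}" by (auto simp: J_def)
    then have finJ: "finite J" by (rule finite_subset) simp
    \<comment> \<open>As \<open>i \<ge> 1\<close>, fewer than \<open>m\<close> neighbours come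
      later; this makes the union bound below strict.\<close>
    have "card J \<le> m - i" using card_mono[OF _ J] by simp
    then have cardJ: "real (card J) < real m" using i by simp
    have bad: "real m * real (card (B j)) \<le> real (card (T i))" if "j \<in> J" for j
    proof -
      have j: "i < j" "j \<le> m" "{v i, v j} \<in> edges F" using that by (auto simp: J_def)
      have "v i \<noteq> v j" using j(3) loopless by metis
      then have "T i \<inter> T j = {}"
        using W_disj[OF vV vV, of i j] TW[of i] TW[of j] i j by fastforce
      then have "real (card (B j)) * real (card (T j)) \<le> D"
        using W[OF vV, of i] W[OF vV, of j] TW[of i] TW[of j] i j
        by (intro mixingD[OF mix]) (auto simp: B_def)
      then have "real m * (real (card (B j)) * real (card (T j))) \<le> real m * D"
        by (intro mult_left_mono) auto
      also have "\<dots> \<le> (real m)\<^sup>2 * D"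
        using m D by (intro mult_right_mono) (auto simp: power2_eq_square)
      \<comment> \<open>Here the degree condition for edges with an early endpoint enters, at stage
        \<open>i\<close>.\<close>
      also have "\<dots> < real (card (T i)) * real (card (T j))"
        using early[of i j] i j large[of i] large[of j] by (intro product) (auto simp: T_def)
      finally have "(real m * real (card (B j))) * real (card (T j))
          < real (card (T i)) * real (card (T j))" by (simp add: mult.assoc)
      then show ?thesis using mult_right_less_imp_less[of _ "real (card (T j))"] by fastforce
    qed
    \<comment> \<open>Each bad set takes at most the fraction \<open>1 / m\<close> of
      \<open>T i\<close>, so fewer than \<open>m\<close> of them cannot cover it.\<close>
    have "real m * real (card (\<Union>j\<in>J. B j)) \<le> real m * (\<Sum>j\<in>J. real (card (B j)))"
      using card_UN_le[OF finJ, of B] by (intro mult_left_mono) (simp_all flip: of_nat_sum)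
    also have "\<dots> = (\<Sum>j\<in>J. real m * real (card (B j)))" by (rule sum_distrib_left)
    also have "\<dots> \<le> real (card J) * real (card (T i))" using bad by (intro sum_bounded_above) auto
    also have "\<dots> < real m * real (card (T i))"
      using cardJ Tpos[of i] i by (intro mult_strict_right_mono) auto
    finally have "card (\<Union>j\<in>J. B j) < card (T i)" using m by simp
    moreover have "finite (\<Union>j\<in>J. B j)" using finJ finT by (auto simp: B_def)
    ultimately have "\<not> T i \<subseteq> (\<Union>j\<in>J. B j)" by (meson card_mono not_le)
    then obtain t where t: "t \<in> T i" "\<And>j. j \<in> J \<Longrightarrow> t \<notin> B j" by blast
    define \<psi> where "\<psi> = \<phi>(v i := t)"
    have new: "v i \<notin> ?U i" using inj_onD[OF inj, of i] i by fastforce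
    have U: "?U (Suc i) = insert (v i) (?U i)" using i by (simp add: atLeastLessThanSuc)
    have "\<psi> x \<in> W x" if "x \<in> ?U (Suc i)" for x
      using that \<phi> t(1) TW[of i] unfolding U \<psi>_def by (cases "x = v i") auto
    moreover have "{\<psi> x, \<psi> y} \<in> edges G"
      if "x \<in> ?U (Suc i)" "y \<in> ?U (Suc i)" "{x, y} \<in> edges F" for x y
    proof -
      \<comment> \<open>As a candidate, \<open>t\<close> is already joined to the images of all
        earlier neighbours of \<open>v i\<close>.\<close>
      have old: "{t, \<phi> z} \<in> edges G" if "z \<in> ?U i" "{v i, z} \<in> edges F" for z
        using that t(1) by (auto simp: T_def candidates_def insert_commute)
      consider "x = v i" "y = v i" | "x = v i" "y \<noteq> v i" "y \<in> ?U i" | "y = v i" "x \<noteq> v i" "x \<in> ?U i"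
        | "x \<noteq> v i" "y \<noteq> v i" "x \<in> ?U i" "y \<in> ?U i"
        using \<open>x \<in> ?U (Suc i)\<close> \<open>y \<in> ?U (Suc i)\<close> unfolding U by blast
      then show ?thesis
      proof cases
        case 1
        then show ?thesis using \<open>{x, y} \<in> edges F\<close> loopless by simp
      next
        case 2
        then show ?thesis using old \<open>{x, y} \<in> edges F\<close> by (simp add: \<psi>_def)
      next
        case 3
        then show ?thesis using old \<open>{x, y} \<in> edges F\<close> by (simp add: \<psi>_def insert_commute)
      next
        case 4
        then show ?thesis using hom \<open>{x, y} \<in> edges F\<close> by (simp add: \<psi>_def)
      qed
    qed
    moreover have "s * q ^ nbrs_before F v (Suc i) (v j)
        \<le> real (card (candidates G F W \<psi> (?U (Suc i)) (v j)))" if j: "j \<in> {Suc i..m}" for j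
    proof (cases "{v j, v i} \<in> edges F")
      case False
      then show ?thesis using large[of j] j i
        by (simp only: U \<psi>_def candidates_insert[OF new] nbrs_before_Suc[OF inj i(1,3)]) simp
    next
      case True
      then have "j \<in> J" using j by (auto simp: J_def insert_commute)
      then have "q * real (card (T j)) < real (card (nbhd G t \<inter> T j))"
        using t unfolding B_def by fastforce
      moreover have "q * (s * q ^ nbrs_before F v i (v j)) \<le> q * real (card (T j))"
        using large[of j] j q by (intro mult_left_mono) (auto simp: T_def)
      ultimately show ?thesis using True
        by (simp only: U \<psi>_def candidates_insert[OF new] nbrs_before_Suc[OF inj i(1,3)] T_def)
          (simp add: mult.left_commute)
    qed
    ultimately show ?case by blast
  qed
  then obtain \<phi> where \<phi>: "\<And>x. x \<in> ?U k \<Longrightarrow> \<phi> x \<in> W x"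
    and hom: "\<And>x y. x \<in> ?U k \<Longrightarrow> y \<in> ?U k \<Longrightarrow> {x, y} \<in> edges F \<Longrightarrow> {\<phi> x, \<phi> y} \<in> edges G"
    and large: "\<And>j. k \<le> j \<Longrightarrow> j \<le> m \<Longrightarrow>
      s * q ^ nbrs_before F v k (v j) \<le> real (card (candidates G F W \<phi> (?U k) (v j)))"
    by fastforce
  define S where "S = v ` {k..m}"
  define T where "T = candidates G F W \<phi> (?U k)"
  have TW: "T x \<subseteq> W x" for x by (auto simp: T_def candidates_def)
  have SV: "S \<subseteq> verts F" using vV k by (auto simp: S_def)
  have Tpos: "0 < card (T x)" if "x \<in> S" for x
  proof -
    obtain j where j: "x = v j" "k \<le> j" "j \<le> m" using \<open>x \<in> S\<close> by (auto simp: S_def)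
    have "0 < s * q ^ nbrs_before F v k (v j)" using s q by simp
    then show ?thesis using large[OF j(2,3)] j(1) by (simp add: T_def)
  qed
  have cardS: "real (card S) \<le> real m"
    using card_image_le[of "{k..m}" v] k by (simp add: S_def)
  have "\<exists>\<psi>. (\<forall>x\<in>S. \<psi> x \<in> T x) \<and>
      (\<forall>x\<in>S. \<forall>y\<in>S. {x, y} \<in> edges F \<longrightarrow> {\<psi> x, \<psi> y} \<in> edges G)"
  \<comment> \<open>The choice \<open>card (T x) / m\<close> meets the size invariant because
    \<open>card S \<le> m\<close>, at the price of a factor \<open>m^2\<close> in the product
    condition.\<close>
  proof (rule forest_embedding[OF F G mix, where s = "\<lambda>x. real (card (T x)) / real m"])
    show "forest (induced_subgraph F S)" using forest by (simp add: S_def)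
    show "T x \<subseteq> verts G" if "x \<in> S" for x using TW W SV that by blast
    show "T x \<inter> T y = {}" if "x \<in> S" "y \<in> S" "x \<noteq> y" for x y
      using TW[of x] TW[of y] W_disj[of x y] SV that by blast
    show "0 < real (card (T x)) / real m" if "x \<in> S" for x using Tpos[OF that] m by simp
    show "real (card (T x)) / real m * real (card S) \<le> real (card (T x))" for x
    proof -
      have "real (card (T x)) * real (card S) \<le> real (card (T x)) * real m"
        using cardS by (intro mult_left_mono) auto
      then show ?thesis using m by (simp add: divide_le_eq)
    qed
    show "D < real (card (T x)) / real m * (real (card (T y)) / real m)"
      if xy: "x \<in> S" "y \<in> S" "{x, y} \<in> edges F" for x y
    proof -
      obtain i j where i: "x = v i" "k \<le> i" "i \<le> m" and j: "y = v j" "k \<le> j" "j \<le> m"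
        using xy(1,2) by (auto simp: S_def)
      have "i \<noteq> j" using xy(3) i(1) j(1) loopless by metis
      then have "real (nbrs_before F v k (v i)) + real (nbrs_before F v k (v j)) \<le> 2 * d"
        using late[of i j] late[of j i] i j k xy(3)
        by (cases i j rule: linorder_cases) (auto simp: insert_commute add.commute)
      then have "(real m)\<^sup>2 * D < real (card (T x)) * real (card (T y))"
        using large[of i] large[of j] i j by (intro product) (auto simp: T_def)
      then show ?thesis using m by (simp add: less_divide_eq power2_eq_square mult.commute)
    qed
  qed (use q in \<open>auto simp: S_def\<close>)
  then obtain \<psi> where \<psi>: "\<And>x. x \<in> S \<Longrightarrow> \<psi> x \<in> T x"
    and homS: "\<And>x y. x \<in> S \<Longrightarrow> y \<in> S \<Longrightarrow> {x, y} \<in> edges F \<Longrightarrow> {\<psi> x, \<psi> y} \<in> edges G"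
    by blast
  define f where "f x = (if x \<in> ?U k then \<phi> x else \<psi> x)" for x
  have "{1..m} = {1..<k} \<union> {k..m}" using k by auto
  then have V: "verts F = ?U k \<union> S" using img by (metis S_def image_Un)
  have fW: "f x \<in> W x" if "x \<in> verts F" for x
    using that \<phi> \<psi> TW unfolding V f_def by fastforce
  have cross: "{\<phi> x, \<psi> y} \<in> edges G" if "x \<in> ?U k" "y \<in> S" "{x, y} \<in> edges F" for x y
    using \<psi>[OF that(2)] that(1,3) by (auto simp: T_def candidates_def insert_commute)
  have "f ` e \<in> edges G" if e: "e \<in> edges F" for e
  proof -
    obtain x y where xy: "e = {x, y}" "x \<in> verts F" "y \<in> verts F"
      using e F unfolding simple_graph_def by (metis card_2_iff insert_subset)
    then have "x \<in> ?U k \<or> x \<in> S" "y \<in> ?U k \<or> y \<in> S" by (auto simp: V)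
    then have "{f x, f y} \<in> edges G"
      using hom[of x y] homS[of x y] cross[of x y] cross[of y x] e xy(1)
      by (auto simp only: f_def insert_commute split: if_split)
    then show ?thesis by (simp add: xy(1))
  qed
  \<comment> \<open>The images lie in pairwise disjoint parts, so injectivity need not be carried
    through the embedding.\<close>
  moreover have "inj_on f (verts F)" using fW W_disj by (fastforce simp: inj_on_def)
  moreover have "f ` verts F \<subseteq> verts G" using fW W by blast
  ultimately show ?thesis unfolding contains_copy_def by blast
qed

section \<open>Bounds on the density and on the number of edges\<close>

text \<open>Enumerate \<open>V\<close> and cut it into consecutive blocks of equal length; the
  remainder of the division is left over.\<close>

lemma disjoint_equal_parts:
  assumes "finite V" "finite I" "I \<noteq> {}"
  shows "\<exists>W. (\<forall>x\<in>I. W x \<subseteq> V \<and> card (W x) = card V div card I) \<and>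
    (\<forall>x\<in>I. \<forall>y\<in>I. x \<noteq> y \<longrightarrow> W x \<inter> W y = {})"
proof -
  define q where "q = card V div card I"
  obtain g where g: "bij_betw g {0..<card V} V"
    using ex_bij_betw_nat_finite[OF assms(1)] by blast
  obtain h where h: "bij_betw h I {0..<card I}"
    using ex_bij_betw_finite_nat[OF assms(2)] by blast
  let ?J = "\<lambda>x. {h x * q ..< Suc (h x) * q}"
  have sub: "?J x \<subseteq> {0..<card V}" if "x \<in> I" for x
  proof -
    have "h x < card I" using bij_betwE[OF h] that by auto
    then have "Suc (h x) * q \<le> card I * q" by (intro mult_right_mono) auto
    also have "\<dots> \<le> card V" by (simp add: q_def)
    finally show ?thesis by auto
  qed
  have inj: "inj_on g {0..<card V}" and img: "g ` {0..<card V} = V"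
    using g by (auto simp: bij_betw_def)
  define W where "W x = g ` ?J x" for x
  have "W x \<subseteq> V" if "x \<in> I" for x
    using image_mono[OF sub[OF that], of g] img by (simp only: W_def)
  moreover have "card (W x) = q" if "x \<in> I" for x
    using card_image[OF inj_on_subset[OF inj sub[OF that]]] by (simp add: W_def)
  moreover have "W x \<inter> W y = {}" if "x \<in> I" "y \<in> I" "x \<noteq> y" for x y
  proof -
    have "h x \<noteq> h y" using that h by (auto simp: bij_betw_def inj_on_def)
    \<comment> \<open>Division by the block length recovers the index of the block, which separates
      different blocks.\<close>
    moreover have "a div q = h z" if "a \<in> ?J z" for a z
      using that by (intro div_nat_eqI) (auto simp: mult.commute)
    ultimately have "?J x \<inter> ?J y = {}" by (metis (no_types, lifting) disjoint_iff)
    then show ?thesis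
      using inj_on_image_Int[OF inj sub[OF that(1)] sub[OF that(2)]] by (simp only: W_def image_empty)
  qed
  ultimately show ?thesis unfolding q_def by metis
qed

lemma mixing_mono: "mixing G q D \<Longrightarrow> D \<le> D' \<Longrightarrow> mixing G q D'"
  unfolding mixing_def by (meson order_trans)

text \<open>If the bound fails, the embedding applies with \<open>q = p / 2\<close>,
  \<open>s = n / (2 m)\<close> and \<open>D = 4 C^2 n / p\<close>. The constant is the one for which
  its size condition becomes the negated bound.\<close>

lemma density_bound:
  fixes F :: "'a ugraph" and G :: "'b ugraph"
  assumes F: "simple_graph F" and adm: "admissible F m d v k"
    and G: "simple_graph G" "card (verts G) = n" "m \<le> n" "\<not> contains_copy G F"
    and jumbled: "jumbled p \<alpha> G" "\<alpha> \<le> C * sqrt (real n * p)"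
  shows "real n * p powr (2 * d + 1) \<le> 16 * real m ^ 4 * C\<^sup>2 * 2 powr (2 * d)"
proof (rule ccontr)
  assume "\<not> ?thesis"
  then have big: "16 * real m ^ 4 * C\<^sup>2 * 2 powr (2 * d) < real n * p powr (2 * d + 1)" by simp
  have p01: "0 \<le> p" "p \<le> 1" and \<alpha>: "0 \<le> \<alpha>"
    using jumbled(1) by (auto simp: jumbled_def)
  have "0 \<le> 16 * real m ^ 4 * C\<^sup>2 * 2 powr (2 * d)" by simp
  then have "0 < real n * p powr (2 * d + 1)" using big by linarith
  \<comment> \<open>The value of \<open>0 powr\<close> any exponent is \<open>0\<close>, so the
    bound cannot fail at \<open>p = 0\<close>.\<close>
  then have "p \<noteq> 0" by auto
  then have p: "0 < p" "p \<le> 1" using p01 by auto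
  have m: "0 < m" using admissibleD(2,3)[OF adm] by simp
  have "verts F = v ` {1..m}" "inj_on v {1..m}"
    using admissibleD(1)[OF adm] by (auto simp: bij_betw_def)
  then have V: "finite (verts F)" "verts F \<noteq> {}" "card (verts F) = m"
    using m by (auto simp: card_image)
  have "finite (verts G)" using G(1) by (simp add: simple_graph_def)
  then obtain W where W: "\<And>x. x \<in> verts F \<Longrightarrow> W x \<subseteq> verts G"
      "\<And>x. x \<in> verts F \<Longrightarrow> card (W x) = n div m"
      "\<And>x y. x \<in> verts F \<Longrightarrow> y \<in> verts F \<Longrightarrow> x \<noteq> y \<Longrightarrow> W x \<inter> W y = {}"
    using disjoint_equal_parts[of "verts G" "verts F"] V G(2) by metis
  define D where "D = 4 * C\<^sup>2 * real n / p"
  have "\<alpha>\<^sup>2 \<le> (C * sqrt (real n * p))\<^sup>2" using \<alpha> jumbled(2) by (intro power_mono)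
  then have "4 * \<alpha>\<^sup>2 / p\<^sup>2 \<le> 4 * (C\<^sup>2 * (real n * p)) / p\<^sup>2"
    using p by (intro divide_right_mono) (auto simp: power_mult_distrib)
  also have "\<dots> = D" using p by (simp add: D_def power2_eq_square)
  finally have mix: "mixing G (p / 2) D"
    using jumbled_imp_mixing[OF G(1) jumbled(1) p(1)] mixing_mono by blast
  have n: "0 < real n" using m G(3) by simp
  define s where "s = real n / (2 * real m)"
  have s: "0 < s" using m n by (simp add: s_def)
  \<comment> \<open>Rounding down loses less than a factor of two because
    \<open>m \<le> n\<close>.\<close>
  have "n < m * (2 * (n div m))"
  proof -
    have "n = m * (n div m) + n mod m" "n mod m < m" using m by simp_all
    moreover have "m \<le> m * (n div m)" using m G(3) by (simp add: div_greater_zero_iff Suc_leI)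
    ultimately show ?thesis by linarith
  qed
  then have "real n < real m * (2 * real (n div m))"
    by (metis of_nat_less_iff of_nat_mult of_nat_numeral)
  then have s_le: "s \<le> real (n div m)" using m by (simp add: s_def divide_le_eq mult_ac)
  \<comment> \<open>The extra factor clears the denominators on both sides of the size condition and
    is cancelled afterwards.\<close>
  have "(real m)\<^sup>2 * D * (4 * (real m)\<^sup>2 * p * 2 powr (2 * d))
      = real n * (16 * real m ^ 4 * C\<^sup>2 * 2 powr (2 * d))"
    using p by (simp add: D_def power2_eq_square power4_eq_xxxx)
  also have "\<dots> < real n * (real n * p powr (2 * d + 1))" using big n by (rule mult_strict_left_mono)
  also have "\<dots> = s\<^sup>2 * (p / 2) powr (2 * d) * (4 * (real m)\<^sup>2 * p * 2 powr (2 * d))"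
    using p m by (simp add: s_def powr_divide powr_add power2_eq_square)
  finally have "(real m)\<^sup>2 * D < s\<^sup>2 * (p / 2) powr (2 * d)"
    using mult_right_less_imp_less p by fastforce
  then have "contains_copy G F"
    using p n s s_le W
    by (intro degenerate_forest_embedding[OF F G(1) mix, where s = s and W = W, OF _ _ _ _ _ _ _ _ adm])
      (auto simp: D_def)
  then show False using G(4) by simp
qed

text \<open>Jumbledness with \<open>X\<close> and \<open>Y\<close> both the whole vertex set counts
  every edge twice and gives \<open>2 |E| \<le> n (n p + \<alpha>)\<close>. The bound
  \<open>K\<close> controls \<open>n p\<close>, and \<open>\<alpha>\<close> is at most
  \<open>C\<close> times the square root of \<open>n p\<close>.\<close>

lemma edges_le_of_density:
  assumes G: "simple_graph G" "card (verts G) = n" "0 < n"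
    and jumbled: "jumbled p \<alpha> G" "\<alpha> \<le> C * sqrt (real n * p)"
    and C: "0 < C" and d: "0 \<le> d" and K: "real n * p powr (2 * d + 1) \<le> K"
  shows "real (card (edges G)) \<le>
    ((1 + C) * K powr (1 / (2 * d + 1)) + C) * (real n * real n powr (1 - 1 / (2 * d + 1)))"
proof -
  define \<theta> where "\<theta> = 1 - 1 / (2 * d + 1)"
  define L where "L = K powr (1 / (2 * d + 1))"
  define x where "x = real n * p"
  have p: "0 \<le> p" and \<alpha>: "0 \<le> \<alpha>" using jumbled(1) by (auto simp: jumbled_def)
  have n: "1 \<le> real n" using G(3) by simp
  \<comment> \<open>This is where \<open>0 \<le> d\<close> is needed: the additive constant
    \<open>C\<close> is later absorbed into \<open>C * real n powr \<theta>\<close>.\<close>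
  have \<theta>: "0 \<le> \<theta>" using d by (simp add: \<theta>_def)
  have L: "0 \<le> L" by (simp add: L_def)
  have x0: "0 \<le> x" using p by (simp add: x_def)
  have "p powr (2 * d + 1) \<le> K / real n" using K n by (simp add: le_divide_eq mult.commute)
  then have "(p powr (2 * d + 1)) powr (1 / (2 * d + 1)) \<le> (K / real n) powr (1 / (2 * d + 1))"
    using d by (intro powr_mono2) auto
  then have "p \<le> (K / real n) powr (1 / (2 * d + 1))" using d p by (simp add: powr_powr)
  moreover have "0 \<le> K" using K n by (smt (verit) mult_nonneg_nonneg powr_ge_zero)
  ultimately have "p \<le> L / real n powr (1 / (2 * d + 1))"
    using n by (simp add: powr_divide L_def)
  then have "x \<le> real n * (L / real n powr (1 / (2 * d + 1)))"
    unfolding x_def by (intro mult_left_mono) auto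
  also have "\<dots> = L * real n powr \<theta>" using n by (simp add: \<theta>_def powr_diff)
  finally have x: "x \<le> L * real n powr \<theta>" .
  have "{e \<in> edges G. \<exists>x\<in>verts G. \<exists>y\<in>verts G. e = {x, y}} = edges G"
    using G(1) unfolding simple_graph_def by (auto simp: card_2_iff)
      (metis insert_subset)
  moreover have "{e \<in> edges G. e \<subseteq> verts G \<inter> verts G} = edges G"
    using G(1) by (auto simp: simple_graph_def)
  ultimately have "e_between G (verts G) (verts G) = 2 * card (edges G)"
    by (simp add: e_between_def)
  then have "\<bar>2 * real (card (edges G)) - p * real n * real n\<bar> \<le> \<alpha> * real n"
    using jumbled(1) G(2) by (auto simp: jumbled_def dest!: spec[of _ "verts G"])
  then have "2 * real (card (edges G)) \<le> real n * (x + \<alpha>)"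
    by (simp add: x_def algebra_simps abs_le_iff)
  also have "x + \<alpha> \<le> (1 + C) * x + C"
  proof -
    \<comment> \<open>A crude estimate that covers small and large \<open>x\<close> at once.\<close>
    have "sqrt x \<le> 1 + x" using x0 by (intro real_le_lsqrt) (auto simp: power2_eq_square algebra_simps)
    then have "C * sqrt x \<le> C * (1 + x)" using C by (intro mult_left_mono) auto
    then show ?thesis using jumbled(2) by (simp add: x_def algebra_simps)
  qed
  also have "\<dots> \<le> (1 + C) * (L * real n powr \<theta>) + C * real n powr \<theta>"
    using x C n \<theta> ge_one_powr_ge_zero[of "real n" \<theta>] by (intro add_mono mult_left_mono) auto
  finally have "2 * real (card (edges G)) \<le> ((1 + C) * L + C) * (real n * real n powr \<theta>)"
    using n by (simp add: algebra_simps mult_left_mono)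
  then show ?thesis unfolding L_def \<theta>_def by linarith
qed

section \<open>Negative \<open>d\<close> and edgeless graphs\<close>

text \<open>Every edge falls under one of the two degree conditions, according to whether its
  smaller index is below \<open>k\<close>, and either one bounds a sum of cardinalities by
  \<open>2 * d\<close>.\<close>

lemma edgeless_or_nonneg:
  assumes "simple_graph F" "admissible F m d v k"
  shows "edges F = {} \<or> 0 \<le> d"
proof (rule disjCI)
  assume neg: "\<not> 0 \<le> d"
  have "{v i, v j} \<notin> edges F" if "i \<in> {1..m}" "j \<in> {1..m}" "i < j" for i j
    using admissibleD(5,6)[OF assms(2) that(1,2)] that(3) neg
    by (smt (verit) not_le of_nat_0_le_iff)
  then have none: "{v i, v j} \<notin> edges F" if "i \<in> {1..m}" "j \<in> {1..m}" "i \<noteq> j" for i j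
    using that by (metis insert_commute linorder_neqE_nat)
  show "edges F = {}"
  proof (rule ccontr)
    assume "edges F \<noteq> {}"
    then obtain x y where xy: "{x, y} \<in> edges F" "x \<in> verts F" "y \<in> verts F" "x \<noteq> y"
      using assms(1) unfolding simple_graph_def
      by (metis card_2_iff ex_in_conv insert_subset)
    have "verts F = v ` {1..m}"
      using admissibleD(1)[OF assms(2)] by (simp add: bij_betw_def)
    then obtain i j where "x = v i" "y = v j" "i \<in> {1..m}" "j \<in> {1..m}"
      using xy(2,3) by (metis imageE)
    then show False using none[of i j] xy(1,4) by auto
  qed
qed

text \<open>Any injection of the vertices is a copy, so no sufficiently large graph is free of an
  edgeless one. This settles negative \<open>d\<close>, where \<open>2 * d + 1\<close> may vanish or
  be negative.\<close>

lemma edgeless_contains_copy: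
  assumes "finite (verts F)" "finite (verts G)" "card (verts F) \<le> card (verts G)" "edges F = {}"
  shows "contains_copy G F"
  using card_le_inj[OF assms(1-3)] assms(4) by (auto simp: contains_copy_def)

section \<open>The extremal number and its exponent\<close>

definition ex_rand_sizes :: "nat \<Rightarrow> real \<Rightarrow> 'a ugraph set \<Rightarrow> nat set" where
  "ex_rand_sizes n C \<F> = {card (edges G) | G :: nat ugraph.
     simple_graph G \<and> card (verts G) = n \<and> free_of \<F> G \<and>
     (\<exists>p \<alpha>. jumbled p \<alpha> G \<and> \<alpha> \<le> C * sqrt (real n * p))}"

lemma ex_rand_eq: "ex_rand n C \<F> = Sup (ex_rand_sizes n C \<F>)"
  by (simp add: ex_rand_def ex_rand_sizes_def)

text \<open>A supremum of naturals is meaningful only for bounded sets; counting all subsets of the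
  vertex set is enough.\<close>

lemma bdd_above_ex_rand_sizes: "bdd_above (ex_rand_sizes n C \<F>)"
proof (rule bdd_aboveI)
  fix e assume "e \<in> ex_rand_sizes n C \<F>"
  then obtain G :: "nat ugraph" where G: "simple_graph G" "card (verts G) = n" "e = card (edges G)"
    by (auto simp: ex_rand_sizes_def)
  have "edges G \<subseteq> Pow (verts G)" "finite (verts G)" using G(1) by (auto simp: simple_graph_def)
  then show "e \<le> 2 ^ n" using G card_mono[of "Pow (verts G)" "edges G"] by (simp add: card_Pow)
qed

lemma ex_rand_mono:
  assumes "C \<le> C'"
  shows "ex_rand n C \<F> \<le> ex_rand n C' \<F>"
proof (cases "ex_rand_sizes n C \<F> = {}")
  case True
  then show ?thesis by (simp add: ex_rand_eq)
next
  case False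
  have "\<alpha> \<le> C' * sqrt (real n * p)" if "\<alpha> \<le> C * sqrt (real n * p)" "jumbled p \<alpha> (G :: nat ugraph)"
    for p \<alpha> G
    using that mult_right_mono[OF assms, of "sqrt (real n * p)"] by (simp add: jumbled_def)
  then have "ex_rand_sizes n C \<F> \<subseteq> ex_rand_sizes n C' \<F>"
    unfolding ex_rand_sizes_def by blast
  then show ?thesis
    using cSup_subset_mono[OF False bdd_above_ex_rand_sizes] by (simp add: ex_rand_eq)
qed

text \<open>A nonempty bounded set of naturals attains its supremum; for the empty set the value is
  \<open>0\<close>, which explains the hypothesis \<open>0 \<le> b\<close>.\<close>

lemma ex_rand_le:
  assumes "0 \<le> b"
    and "\<And>(G :: nat ugraph) p \<alpha>. simple_graph G \<Longrightarrow> card (verts G) = n \<Longrightarrow> free_of \<F> G \<Longrightarrow>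
      jumbled p \<alpha> G \<Longrightarrow> \<alpha> \<le> C * sqrt (real n * p) \<Longrightarrow> real (card (edges G)) \<le> b"
  shows "real (ex_rand n C \<F>) \<le> b"
proof (cases "ex_rand_sizes n C \<F> = {}")
  case True
  then show ?thesis using assms(1) by (simp add: ex_rand_eq)
next
  case False
  then have "ex_rand n C \<F> \<in> ex_rand_sizes n C \<F>"
    using Max_in[OF _ False] bdd_above_ex_rand_sizes[of n C \<F>]
    by (simp add: ex_rand_eq Sup_nat_def bdd_above_nat)
  then show ?thesis using assms(2) by (auto simp: ex_rand_sizes_def)
qed

lemma log_ereal_mono: "x \<le> y \<Longrightarrow> log_ereal x \<le> log_ereal y"
  by (auto simp: log_ereal_def)

text \<open>The limsup is nondecreasing in \<open>C\<close>, hence converges to its supremum.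
  Convergence must be shown first, since \<open>Lim\<close> is defined by description.\<close>

lemma exp_rand_family_le:
  assumes "\<And>C. 0 < C \<Longrightarrow>
    limsup (\<lambda>n. log_ereal (real (ex_rand n C \<F>) / real n) / ereal (ln (real n))) \<le> b"
  shows "exp_rand_family \<F> \<le> b"
proof -
  define f where
    "f C = limsup (\<lambda>n. log_ereal (real (ex_rand n C \<F>) / real n) / ereal (ln (real n)))" for C
  have mono: "f C \<le> f C'" if "C \<le> C'" for C C'
    unfolding f_def
  proof (rule Limsup_mono)
    show "\<forall>\<^sub>F n in sequentially. log_ereal (real (ex_rand n C \<F>) / real n) / ereal (ln (real n))
        \<le> log_ereal (real (ex_rand n C' \<F>) / real n) / ereal (ln (real n))"
      \<comment> \<open>From \<open>n = 2\<close> on \<open>ln n\<close> is positive, so division by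
        it preserves order.\<close>
      using eventually_ge_at_top[of 2]
    proof eventually_elim
      case (elim n)
      then show ?case using ex_rand_mono[OF that, of n \<F>]
        by (intro ereal_divide_right_mono log_ereal_mono divide_right_mono) auto
    qed
  qed
  have "(f \<longlongrightarrow> (SUP C. f C)) at_top"
  proof (rule increasing_tendsto)
    fix y assume "y < (SUP C. f C)"
    then obtain C where C: "y < f C" by (auto simp: less_SUP_iff)
    show "\<forall>\<^sub>F C in at_top. y < f C"
      using eventually_ge_at_top[of C]
      by eventually_elim (rule less_le_trans[OF C mono])
  qed (auto intro!: always_eventually SUP_upper)
  then have "exp_rand_family \<F> = (SUP C. f C)"
    unfolding exp_rand_family_def f_def by (intro tendsto_Lim) auto
  also have "\<dots> \<le> b"
  proof (rule SUP_least)
    fix C :: real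
    \<comment> \<open>The hypothesis covers positive \<open>C\<close> only; monotonicity takes care
      of the others.\<close>
    have "f C \<le> f (max C 1)" by (rule mono) simp
    also have "\<dots> \<le> b" using assms[of "max C 1"] by (simp add: f_def)
    finally show "f C \<le> b" .
  qed
  finally show ?thesis .
qed

text \<open>Taking logarithms turns the constant \<open>M\<close> into the term
  \<open>ln M / ln n\<close>, which tends to \<open>0\<close>.\<close>

lemma limsup_log_le:
  fixes a :: "nat \<Rightarrow> real"
  assumes "0 < M" and le: "\<forall>\<^sub>F n in sequentially. a n \<le> M * (real n * real n powr \<theta>)"
  shows "limsup (\<lambda>n. log_ereal (a n / real n) / ereal (ln (real n))) \<le> ereal \<theta>"
proof -
  have "limsup (\<lambda>n. log_ereal (a n / real n) / ereal (ln (real n)))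
      \<le> limsup (\<lambda>n. ereal (ln M / ln (real n) + \<theta>))"
  proof (rule Limsup_mono)
    show "\<forall>\<^sub>F n in sequentially. log_ereal (a n / real n) / ereal (ln (real n))
        \<le> ereal (ln M / ln (real n) + \<theta>)"
      using le eventually_ge_at_top[of 2]
    proof eventually_elim
      case (elim n)
      then have n: "0 < real n" "0 < ln (real n)" by auto
      have "a n / real n \<le> M * real n powr \<theta>"
        using elim(1) n by (simp add: divide_le_eq mult_ac)
      then have "log_ereal (a n / real n) \<le> log_ereal (M * real n powr \<theta>)"
        by (rule log_ereal_mono)
      also have "\<dots> = ereal (ln M + \<theta> * ln (real n))"
        using assms(1) n by (simp add: log_ereal_def ln_mult ln_powr not_le)
      finally have "log_ereal (a n / real n) / ereal (ln (real n))
          \<le> ereal (ln M + \<theta> * ln (real n)) / ereal (ln (real n))"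
        using n by (intro ereal_divide_right_mono) auto
      then show ?case using n by (simp add: add_divide_distrib)
    qed
  qed
  also have "\<dots> = ereal \<theta>"
  proof (rule lim_imp_Limsup)
    have "(\<lambda>n. ln M / ln (real n)) \<longlonglongrightarrow> 0"
      by (intro tendsto_divide_0[OF tendsto_const] filterlim_at_top_imp_at_infinity
          filterlim_compose[OF ln_at_top] filterlim_real_sequentially)
    then have "(\<lambda>n. ln M / ln (real n) + \<theta>) \<longlonglongrightarrow> 0 + \<theta>"
      by (intro tendsto_add tendsto_const)
    then show "(\<lambda>n. ereal (ln M / ln (real n) + \<theta>)) \<longlonglongrightarrow> ereal \<theta>" by simp
  qed simp
  finally show ?thesis .
qed

section \<open>Combining the bounds\<close>

lemma ex_rand_polynomial_bound:
  assumes F: "simple_graph F" and adm: "admissible F m d v k" and C: "0 < C"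
  shows "\<exists>M>0. \<forall>n\<ge>m. real (ex_rand n C {F}) \<le> M * (real n * real n powr (1 - 1 / (2 * d + 1)))"
proof -
  have m: "0 < m" using admissibleD(2,3)[OF adm] by simp
  have cardF: "card (verts F) = m"
    using bij_betw_same_card[OF admissibleD(1)[OF adm]] by simp
  define K where "K = 16 * real m ^ 4 * C\<^sup>2 * 2 powr (2 * d)"
  define M where "M = (1 + C) * K powr (1 / (2 * d + 1)) + C"
  have M: "0 < M" using C by (auto simp: M_def intro!: add_nonneg_pos)
  have "real (ex_rand n C {F}) \<le> M * (real n * real n powr (1 - 1 / (2 * d + 1)))"
    if n: "m \<le> n" for n
  proof (rule ex_rand_le)
    show "0 \<le> M * (real n * real n powr (1 - 1 / (2 * d + 1)))" using M by simp
    fix G :: "nat ugraph" and p \<alpha>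
    assume G: "simple_graph G" "card (verts G) = n" "free_of {F} G"
      "jumbled p \<alpha> G" "\<alpha> \<le> C * sqrt (real n * p)"
    have free: "\<not> contains_copy G F" using G(3) by (simp add: free_of_def)
    \<comment> \<open>An edgeless \<open>F\<close> would be contained in \<open>G\<close> because
      \<open>m \<le> n\<close>; so \<open>F\<close> has an edge and \<open>d\<close> is
      nonnegative.\<close>
    then have "edges F \<noteq> {}"
      using edgeless_contains_copy[of F G] F G(1,2) n cardF by (auto simp: simple_graph_def)
    then have d: "0 \<le> d" using edgeless_or_nonneg[OF F adm] by simp
    have "real n * p powr (2 * d + 1) \<le> K"
      unfolding K_def using density_bound[OF F adm G(1,2) n free G(4,5)] .
    then show "real (card (edges G)) \<le> M * (real n * real n powr (1 - 1 / (2 * d + 1)))"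
      unfolding M_def using m n by (intro edges_le_of_density[OF G(1,2) _ G(4,5) C d]) auto
  qed
  then show ?thesis using M by blast
qed

theorem theorem1p3:
  fixes F :: "'a ugraph" and m :: nat and d :: real
  assumes "simple_graph F" and "card (verts F) = m"
    and "\<exists>(v :: nat \<Rightarrow> 'a) (k :: nat).
      bij_betw v {1..m} (verts F) \<and> 1 \<le> k \<and> k \<le> m \<and>
      forest (induced_subgraph F (v ` {k..m})) \<and>
      (\<forall>i\<in>{1..m}. \<forall>j\<in>{1..m}. {v i, v j} \<in> edges F \<and> i < j \<and> i < k \<longrightarrow>
         real (nbrs_before F v i (v i)) + real (nbrs_before F v i (v j)) \<le> 2 * d) \<and>
      (\<forall>i\<in>{1..m}. \<forall>j\<in>{1..m}. {v i, v j} \<in> edges F \<and> k \<le> i \<and> i < j \<longrightarrow>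
         real (nbrs_before F v k (v i)) + real (nbrs_before F v k (v j)) \<le> 2 * d)"
  shows "exp_rand F \<le> ereal (1 - 1 / (2 * d + 1))"
proof -
  obtain v k where "admissible F m d v k"
    using assms(3) unfolding admissible_def by blast
  then have bound: "\<exists>M>0. \<forall>n\<ge>m. real (ex_rand n C {F})
      \<le> M * (real n * real n powr (1 - 1 / (2 * d + 1)))" if "0 < C" for C
    using ex_rand_polynomial_bound[OF assms(1)] that by blast
  show ?thesis
    unfolding exp_rand_def
  proof (rule exp_rand_family_le)
    fix C :: real assume "0 < C"
    then obtain M where "0 < M"
      "\<And>n. m \<le> n \<Longrightarrow> real (ex_rand n C {F}) \<le> M * (real n * real n powr (1 - 1 / (2 * d + 1)))"
      using bound by blast
    then show "limsup (\<lambda>n. log_ereal (real (ex_rand n C {F}) / real n) / ereal (ln (real n)))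
        \<le> ereal (1 - 1 / (2 * d + 1))"
      by (intro limsup_log_le) (auto simp: eventually_at_top_linorder)
  qed
qed

end
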